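(* If $k$ and $j$ are non-negative integers, then $$\frac{1}{(q^2;q^2)_\infty(q;q^2)_\infty^2}=q^{-k^2}\sum_{m=0}^{j} \binom{2m+2k}{m+2k}C_{m+k}(q) + O\left(q^{(j+1)(j+2k+1)}\right).$$ In particular, if $n$ is a non-negative integer with $n<(j+1)(j+2k+1)$, then $$\overline{p}(n)= \sum_{m=0}^j \binom{2m+2k}{m+2k}\,\mathfrak{m}_{\mathrm{odd}}\left(m+k;\,n+k^2\right).$$
   Context: All identities are between formal (Laurent) power series in $q$, and $O(q^N)$ denotes a power series in $q$ all of whose terms have exponent at least $N$. The $q$-Pochhammer symbol is $(a;q)_\infty:=(1-a)(1-aq)(1-aq^2)\cdots$, so $(q^2;q^2)_\infty=\prod_{n\ge1}(1-q^{2n})$ and $(q;q^2)_\infty=\prod_{n\ge1}(1-q^{2n-1})$. For a positive integer $k$, MacMahon's $q$-series is $$C_k(q):=\sum_{0<s_1<s_2<\cdots<s_k}\frac{q^{2s_1+2s_2+\cdots+2s_k-k}}{(1-q^{2s_1-1})^2(1-q^{2s_2-1})^2\cdots(1-q^{2s_k-1})^2},$$ where the sum runs over strictly increasing $k$-tuples of positive integers, and $C_0(q):=1$. For non-negative integers $k,n$, $\mathfrak{m}_{\mathrm{odd}}(k;n)$ denotes the coefficient of $q^n$ in $C_k(q)$ (so $\mathfrak m_{\mathrm{odd}}(0;0)=1$ and $\mathfrak m_{\mathrm{odd}}(0;n)=0$ for $n\ge1$). An overpartition of $n$ is a nonincreasing sequence of positive integers with sum $n$ in which the first occurrence of each integer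 may be overlined; $\overline{p}(n)$ is the number of overpartitions of $n$ (with $\overline p(0)=1$), and its generating function is $\sum_{n\ge0}\overline{p}(n)q^n=\dfrac{1}{(q^2;q^2)_\infty(q;q^2)_\infty^2}$. *)

theory Defs
  imports
    "HOL-Analysis.Analysis"
    "HOL-Computational_Algebra.Formal_Laurent_Series"
begin

text \<open>
  Formal power series are taken over the rationals, so that a series with non-zero constant
  coefficient can be inverted. Infinite sums and products are the library's \<^const>\<open>infsum\<close> and
  \<^const>\<open>prodinf\<close> in the topology that the library puts on formal power series, i.e. the
  $X$-adic one.
\<close>

definition qpoch_inf :: "rat fps \<Rightarrow> rat fps \<Rightarrow> rat fps" where
  "qpoch_inf a q = prodinf (\<lambda>i. 1 - a * q ^ i)"

definition increasing_tuples :: "nat \<Rightarrow> nat list set" where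
  "increasing_tuples k = {s. length s = k \<and> sorted_wrt (<) s \<and> (\<forall>i\<in>set s. 0 < i)}"

text \<open>
  The truncated subtractions below never truncate, as all entries of a tuple in
  \<^const>\<open>increasing_tuples\<close> are positive.
\<close>

definition macmahon_C_term :: "nat \<Rightarrow> nat list \<Rightarrow> rat fps" where
  "macmahon_C_term k s =
     fps_X ^ ((\<Sum>i<k. 2 * s ! i) - k) / (\<Prod>i<k. (1 - fps_X ^ (2 * s ! i - 1))\<^sup>2)"

definition macmahon_C :: "nat \<Rightarrow> rat fps" where
  "macmahon_C k = (\<Sum>\<^sub>\<infinity>s\<in>increasing_tuples k. macmahon_C_term k s)"

definition m_odd :: "nat \<Rightarrow> nat \<Rightarrow> rat" where
  "m_odd k n = fps_nth (macmahon_C k) n"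

text \<open>
  An overpartition is encoded as the list of its parts in nonincreasing order, each paired with
  a flag that tells whether this occurrence of the part is overlined.
\<close>

definition overpartitions :: "nat \<Rightarrow> (nat \<times> bool) list set" where
  "overpartitions n = {xs.
     (\<forall>x\<in>set xs. 0 < fst x) \<and>
     sorted_wrt (\<ge>) (map fst xs) \<and>
     sum_list (map fst xs) = n \<and>
     (\<forall>i<length xs. snd (xs ! i) \<longrightarrow> (\<forall>j<i. fst (xs ! j) \<noteq> fst (xs ! i)))}"

definition overpartition_number :: "nat \<Rightarrow> nat" where
  "overpartition_number n = card (overpartitions n)"

text \<open>
  The class $O(q^N)$, embedded in the formal Laurent series. As \<open>N\<close> is non-negative, its members
  are power series.
\<close>

definition q_bigo :: "nat \<Rightarrow> rat fls set" where
  "q_bigo N = {f. \<forall>i<int N. fls_nth f i = 0}"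

text \<open>
  None of the above takes a default value: the products and sums converge, and the sets that
  are counted are finite.
\<close>

lemma has_prod_qpoch_inf:
  assumes "fps_nth a 0 = 0" "fps_nth q 0 = 0"
  shows "(\<lambda>i. 1 - a * q ^ i) has_prod qpoch_inf a q"
proof -
  define P where "P = (\<lambda>N. \<Prod>i\<le>N. 1 - a * q ^ i)"
  define L where "L = Abs_fps (\<lambda>n. fps_nth (P n) n)"
  have small: "fps_nth (f * (a * q ^ m)) n = 0" if "n < m" for f n m
  proof -
    have "fps_nth (q ^ m) i = 0" if "i < m" for i
      using startsby_zero_power_prefix[OF assms(2)] that by blast
    then have "fps_nth (f * a * q ^ m) n = 0"
      unfolding fps_mult_nth[of "f * a"] using that by (intro sum.neutral) auto
    then show ?thesis
      by (simp add: mult.assoc)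
  qed
  have stable: "fps_nth (P N) n = fps_nth (P n) n" if "n \<le> N" for n N
    using that
  proof (induction N rule: dec_induct)
    case (step N)
    have "P (Suc N) = P N - P N * (a * q ^ Suc N)"
      by (simp add: P_def algebra_simps)
    then show ?case
      using step small[of n "Suc N" "P N"] by (simp del: power_Suc)
  qed simp
  have "P \<longlonglongrightarrow> L"
    by (intro tendsto_fpsI eventually_sequentiallyI) (unfold L_def fps_nth_Abs_fps, rule stable)
  moreover have "fps_nth L 0 = 1"
    using assms by (simp add: L_def P_def)
  then have "L \<noteq> 0"
    by auto
  ultimately have "(\<lambda>i. 1 - a * q ^ i) has_prod L"
    by (simp add: has_prod_def raw_has_prod_def P_def)
  then show ?thesis
    using has_prod_unique by (auto simp: qpoch_inf_def)
qed

lemma macmahon_C_0: "macmahon_C 0 = 1"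
proof -
  have "increasing_tuples 0 = {[]}"
    by (auto simp: increasing_tuples_def)
  then show ?thesis
    by (simp add: macmahon_C_def macmahon_C_term_def)
qed

lemma summable_macmahon_C: "macmahon_C_term k summable_on increasing_tuples k"
proof -
  have fin: "finite {s \<in> increasing_tuples k. fps_nth (macmahon_C_term k s) n \<noteq> 0}" for n
  proof (rule finite_subset)
    show "{s \<in> increasing_tuples k. fps_nth (macmahon_C_term k s) n \<noteq> 0}
        \<subseteq> {s. set s \<subseteq> {..n + k} \<and> length s = k}"
    proof (intro subsetI CollectI conjI)
      fix s
      assume "s \<in> {s \<in> increasing_tuples k. fps_nth (macmahon_C_term k s) n \<noteq> 0}"
      then have s: "s \<in> increasing_tuples k" "fps_nth (macmahon_C_term k s) n \<noteq> 0"
        by auto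
      then show "length s = k"
        by (simp add: increasing_tuples_def)
      fix x
      assume x: "x \<in> set s"
      from s(1) have len: "length s = k" and pos: "\<And>i. i < k \<Longrightarrow> 0 < s ! i"
        by (auto simp: increasing_tuples_def)
      define D :: "rat fps" where "D = (\<Prod>i<k. (1 - fps_X ^ (2 * s ! i - 1))\<^sup>2)"
      define e where "e = (\<Sum>i<k. 2 * s ! i) - k"
      have nth_0_prod: "fps_nth (prod f A) 0 = (\<Prod>i\<in>A. fps_nth (f i) 0)"
        for f :: "nat \<Rightarrow> rat fps" and A
        by (induction A rule: infinite_finite_induct) auto
      have "fps_nth D 0 = (\<Prod>i<k. fps_nth ((1 - fps_X ^ (2 * s ! i - 1))\<^sup>2) 0)"
        unfolding D_def by (rule nth_0_prod)
      also have "\<dots> = 1"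
      proof (intro prod.neutral ballI)
        fix i
        assume "i \<in> {..<k}"
        then have "2 * s ! i - 1 \<noteq> 0"
          using pos[of i] by simp
        then show "fps_nth ((1 - fps_X ^ (2 * s ! i - 1))\<^sup>2 :: rat fps) 0 = 1"
          by (simp add: power2_eq_square)
      qed
      finally have "macmahon_C_term k s = fps_X ^ e * inverse D"
        by (simp add: macmahon_C_term_def D_def e_def fps_divide_unit)
      with s(2) have "e \<le> n"
        by (auto simp: fps_X_power_mult_nth split: if_splits)
      obtain i where i: "i < k" "x = s ! i"
        using x len by (auto simp: in_set_conv_nth)
      have "s ! i \<le> (\<Sum>i<k. s ! i)"
        using i by (intro member_le_sum) auto
      moreover have "(\<Sum>i<k. 1) \<le> (\<Sum>i<k. s ! i)"
        using pos by (intro sum_mono) (simp add: Suc_leI)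
      ultimately show "x \<in> {..n + k}"
        using \<open>e \<le> n\<close> i by (simp add: e_def flip: sum_distrib_left)
    qed
    show "finite {s. set s \<subseteq> {..n + k} \<and> length s = k}"
      by (rule finite_lists_length_eq) simp
  qed
  have "(macmahon_C_term k has_sum
          Abs_fps (\<lambda>n. \<Sum>s | s \<in> increasing_tuples k \<and> fps_nth (macmahon_C_term k s) n \<noteq> 0.
                         fps_nth (macmahon_C_term k s) n)) (increasing_tuples k)"
    by (rule has_sum_fpsI) (use fin in auto)
  then show ?thesis
    by (rule has_sum_imp_summable)
qed

lemma finite_overpartitions: "finite (overpartitions n)"
proof (rule finite_subset)
  show "overpartitions n \<subseteq> {xs. set xs \<subseteq> {..n} \<times> UNIV \<and> length xs \<le> n}"
  proof
    fix xs
    assume "xs \<in> overpartitions n"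
    then have pos: "\<forall>x\<in>set xs. 0 < fst x" and sum: "sum_list (map fst xs) = n"
      by (auto simp: overpartitions_def)
    have "fst x \<le> n" if "x \<in> set xs" for x
      unfolding sum[symmetric] by (rule member_le_sum_list) (use that in auto)
    moreover have "length xs \<le> sum_list (map fst xs)"
      using pos by (induction xs) auto
    ultimately show "xs \<in> {xs. set xs \<subseteq> {..n} \<times> UNIV \<and> length xs \<le> n}"
      using sum by auto
  qed
  show "finite {xs. set xs \<subseteq> {..n} \<times> (UNIV :: bool set) \<and> length xs \<le> n}"
    by (rule finite_lists_length_le) simp
qed

end

theory Submission
  imports Defs
begin

text \<open>
  With $x_i = q^{2i-1}/(1-q^{2i-1})^2$, the series $C_m$ is the $m$-th elementary symmetric function
  of the $x_i$, so $\sum_m C_m X^m = \prod_i (1 + X x_i)$. Substituting $X = z + 2 + z^{-1}$ turns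
  each factor into $(1+zq^{2i-1})(1+z^{-1}q^{2i-1})/(1-q^{2i-1})^2$, while the coefficient of $z^k$
  in $X^m$ is $\binom{2m}{m+k}$. Comparing coefficients of $z^k$ by the Jacobi triple product gives
  $\sum_m \binom{2m}{m+k} C_m = q^{k^2}/((q^2;q^2)_\infty (q;q^2)_\infty^2)$, and the terms with
  $m > k + j$ do not matter because $C_m = O(q^{m^2})$ and $(k+j+1)^2 - k^2 = (j+1)(j+2k+1)$.
  Laurent series in $z$ are avoided: for the product over $i \le N$, both sides satisfy the same
  recurrence in $N$ for their coefficients, and $N \to \infty$ afterwards.
\<close>

subsection \<open>Limits of formal power series\<close>

text \<open>Convergence means that each coefficient eventually agrees with that of the limit, and
  coefficient \<open>n\<close> of a product depends on finitely many coefficients of the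
  factors.\<close>

lemma tendsto_mult_fps:
  fixes f g :: "'b \<Rightarrow> 'a :: comm_ring_1 fps"
  assumes "(f \<longlongrightarrow> a) F" "(g \<longlongrightarrow> b) F"
  shows "((\<lambda>x. f x * g x) \<longlongrightarrow> a * b) F"
proof (rule tendsto_fpsI)
  fix n
  have "\<forall>\<^sub>F x in F. \<forall>i\<in>{..n}. fps_nth (f x) i = fps_nth a i"
       "\<forall>\<^sub>F x in F. \<forall>i\<in>{..n}. fps_nth (g x) i = fps_nth b i"
    using assms by (auto simp: tendsto_fps_iff intro!: eventually_ball_finite)
  then show "\<forall>\<^sub>F x in F. fps_nth (f x * g x) n = fps_nth (a * b) n"
    by eventually_elim (auto simp: fps_mult_nth intro!: sum.cong)
qed

lemma tendsto_qpoch_inf: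
  assumes "fps_nth a 0 = 0" "fps_nth q 0 = 0"
  shows "(\<lambda>N. \<Prod>i<N. 1 - a * q ^ i) \<longlonglongrightarrow> qpoch_inf a q"
  using has_prod_imp_tendsto'[OF has_prod_qpoch_inf[OF assms]] .

lemma fps_nth_0_prod:
  fixes f :: "'b \<Rightarrow> 'a :: comm_ring_1 fps"
  shows "fps_nth (prod f A) 0 = (\<Prod>i\<in>A. fps_nth (f i) 0)"
  by (induction A rule: infinite_finite_induct) auto

lemma fps_nth_0_qpoch_inf:
  assumes "fps_nth a 0 = 0" "fps_nth q 0 = 0"
  shows "fps_nth (qpoch_inf a q) 0 = 1"
proof -
  have "\<forall>\<^sub>F N in sequentially. fps_nth (\<Prod>i<N. 1 - a * q ^ i) 0 = fps_nth (qpoch_inf a q) 0"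
    using tendsto_qpoch_inf[OF assms] by (simp add: tendsto_fps_iff)
  then obtain N where "fps_nth (\<Prod>i<N. 1 - a * q ^ i) 0 = fps_nth (qpoch_inf a q) 0"
    by (auto simp: eventually_sequentially)
  then show ?thesis
    using assms by (simp add: fps_nth_0_prod)
qed

subsection \<open>Finite products\<close>

definition odd_poch :: "nat \<Rightarrow> rat fps" where
  "odd_poch N = (\<Prod>i<N. 1 - fps_X ^ (2 * i + 1))"

definition even_poch :: "nat \<Rightarrow> rat fps" where
  "even_poch N = (\<Prod>i<N. 1 - fps_X ^ (2 * i + 2))"

text \<open>The quotient (-q;q)_N / (q;q)_N generates the overpartitions with parts at most N.
  Euler's identity leads from there to the product in the theorem.\<close>

definition minus_poch :: "nat \<Rightarrow> rat fps" where
  "minus_poch N = (\<Prod>i<N. 1 - fps_X ^ (i + 1))"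

definition plus_poch :: "nat \<Rightarrow> rat fps" where
  "plus_poch N = (\<Prod>i<N. 1 + fps_X ^ (i + 1))"

lemma odd_poch_LIMSEQ: "odd_poch \<longlonglongrightarrow> qpoch_inf fps_X (fps_X ^ 2)"
  using tendsto_qpoch_inf[of fps_X "fps_X ^ 2"]
  by (simp add: odd_poch_def[abs_def] flip: power_mult)

lemma even_poch_LIMSEQ: "even_poch \<longlonglongrightarrow> qpoch_inf (fps_X ^ 2) (fps_X ^ 2)"
  using tendsto_qpoch_inf[of "fps_X ^ 2" "fps_X ^ 2"]
  by (simp add: even_poch_def[abs_def] add.commute flip: power_add power_mult)

lemma minus_poch_LIMSEQ: "minus_poch \<longlonglongrightarrow> qpoch_inf fps_X fps_X"
  using tendsto_qpoch_inf[of fps_X fps_X] by (simp add: minus_poch_def[abs_def])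

lemma plus_poch_LIMSEQ: "plus_poch \<longlonglongrightarrow> qpoch_inf (- fps_X) fps_X"
  using tendsto_qpoch_inf[of "- fps_X" fps_X] by (simp add: plus_poch_def[abs_def])

text \<open>The exponents 1, ..., 2N are sorted by parity.\<close>

lemma minus_poch_double: "minus_poch (2 * N) = even_poch N * odd_poch N"
  by (induction N) (simp_all add: minus_poch_def even_poch_def odd_poch_def)

lemma minus_poch_mult_plus_poch: "minus_poch N * plus_poch N = even_poch N"
  unfolding minus_poch_def plus_poch_def even_poch_def prod.distrib[symmetric]
proof (intro prod.cong refl)
  fix i
  have "fps_X ^ (2 * i + 2) = (fps_X ^ (i + 1) * fps_X ^ (i + 1) :: rat fps)"
    by (simp add: mult_2 del: power_Suc flip: power_add)
  then show "(1 - fps_X ^ (i + 1)) * (1 + fps_X ^ (i + 1)) = (1 - fps_X ^ (2 * i + 2) :: rat fps)"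
    by (simp only:) (simp add: algebra_simps)
qed

lemma even_poch_nth_0: "fps_nth (even_poch N) 0 = 1"
  by (simp add: even_poch_def fps_nth_0_prod)

lemma qpoch_inf_X: "qpoch_inf fps_X fps_X = qpoch_inf (fps_X ^ 2) (fps_X ^ 2) * qpoch_inf fps_X (fps_X ^ 2)"
proof (rule LIMSEQ_unique)
  show "(\<lambda>N. minus_poch (2 * N)) \<longlonglongrightarrow> qpoch_inf fps_X fps_X"
    using LIMSEQ_subseq_LIMSEQ[OF minus_poch_LIMSEQ, of "\<lambda>N. 2 * N"]
    by (simp add: strict_mono_def comp_def)
  show "(\<lambda>N. minus_poch (2 * N)) \<longlonglongrightarrow>
          qpoch_inf (fps_X ^ 2) (fps_X ^ 2) * qpoch_inf fps_X (fps_X ^ 2)"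
    unfolding minus_poch_double by (intro tendsto_mult_fps even_poch_LIMSEQ odd_poch_LIMSEQ)
qed

text \<open>Euler's identity between odd and distinct parts. By differences of squares (q;q)(-q;q) =
  (q^2;q^2), and by parity (q;q) = (q^2;q^2)(q;q^2), so (q^2;q^2) cancels.\<close>

lemma qpoch_inf_odd_plus: "qpoch_inf fps_X (fps_X ^ 2) * qpoch_inf (- fps_X) fps_X = 1"
proof -
  let ?a = "qpoch_inf (fps_X ^ 2) (fps_X ^ 2)" and ?b = "qpoch_inf fps_X (fps_X ^ 2)"
  let ?d = "qpoch_inf (- fps_X) fps_X"
  have "even_poch \<longlonglongrightarrow> qpoch_inf fps_X fps_X * ?d"
    using tendsto_mult_fps[OF minus_poch_LIMSEQ plus_poch_LIMSEQ]
    by (simp add: minus_poch_mult_plus_poch)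
  then have "qpoch_inf fps_X fps_X * ?d = ?a"
    using even_poch_LIMSEQ LIMSEQ_unique by blast
  then have "?a * (?b * ?d) = ?a * 1"
    by (simp add: qpoch_inf_X mult.assoc)
  moreover have "?a \<noteq> 0"
    using fps_nth_0_qpoch_inf[of "fps_X ^ 2" "fps_X ^ 2"] by auto
  ultimately show ?thesis
    by (simp only: mult_cancel_left) auto
qed

subsection \<open>Overpartitions\<close>

definition overpartitions_le :: "nat \<Rightarrow> nat \<Rightarrow> (nat \<times> bool) list set" where
  "overpartitions_le M n = {xs \<in> overpartitions n. \<forall>x\<in>set xs. fst x \<le> M}"

text \<open>An intermediate family, which lets the step from parts at most M to parts at most M + 1
  remove one leading part at a time.\<close>

definition overpartitions_plain :: "nat \<Rightarrow> nat \<Rightarrow> (nat \<times> bool) list set" where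
  "overpartitions_plain M n = {xs \<in> overpartitions_le M n. (M, True) \<notin> set xs}"

text \<open>The new head is the first occurrence of its value, so no later occurrence may be
  overlined.\<close>

lemma Cons_in_overpartitions_iff:
  "x # xs \<in> overpartitions n \<longleftrightarrow>
     0 < fst x \<and> fst x \<le> n \<and> (\<forall>y\<in>set xs. fst y \<le> fst x) \<and> (fst x, True) \<notin> set xs \<and>
     xs \<in> overpartitions (n - fst x)"
proof -
  have "(fst x, True) \<notin> set xs \<longleftrightarrow> (\<forall>i<length xs. snd (xs ! i) \<longrightarrow> fst x \<noteq> fst (xs ! i))"
    by (auto simp: in_set_conv_nth prod_eq_iff)
  then have "(\<forall>i<length (x # xs). snd ((x # xs) ! i) \<longrightarrow> (\<forall>j<i. fst ((x # xs) ! j) \<noteq> fst ((x # xs) ! i)))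
     \<longleftrightarrow> (fst x, True) \<notin> set xs \<and>
         (\<forall>i<length xs. snd (xs ! i) \<longrightarrow> (\<forall>j<i. fst (xs ! j) \<noteq> fst (xs ! i)))"
    by (auto simp: All_less_Suc2)
  then show ?thesis
    unfolding overpartitions_def by auto
qed

lemma Nil_in_overpartitions_iff: "[] \<in> overpartitions n \<longleftrightarrow> n = 0"
  by (auto simp: overpartitions_def)

lemma overpartition_part_le:
  assumes "xs \<in> overpartitions n" "x \<in> set xs"
  shows "fst x \<le> n"
  using assms member_le_sum_list[of "fst x" "map fst xs"] by (auto simp: overpartitions_def)

lemma finite_overpartitions_le: "finite (overpartitions_le M n)"
  using finite_overpartitions[of n] by (simp add: overpartitions_le_def)

lemma finite_overpartitions_plain: "finite (overpartitions_plain M n)"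
  using finite_overpartitions_le[of M n] by (simp add: overpartitions_plain_def)

lemma Nil_in_overpartitions_le_iff: "[] \<in> overpartitions_le M n \<longleftrightarrow> n = 0"
  by (simp add: overpartitions_le_def Nil_in_overpartitions_iff)

lemma Cons_in_overpartitions_le_iff:
  "(p, b) # xs \<in> overpartitions_le M n \<longleftrightarrow>
     0 < p \<and> p \<le> n \<and> p \<le> M \<and> (p, True) \<notin> set xs \<and> xs \<in> overpartitions_le p (n - p)"
  by (auto simp: overpartitions_le_def Cons_in_overpartitions_iff)

lemma overpartitions_le_not_mem:
  "xs \<in> overpartitions_le p n \<Longrightarrow> p \<le> M \<Longrightarrow> (Suc M, b) \<notin> set xs"
  by (force simp: overpartitions_le_def)

text \<open>If \<open>Suc M\<close> occurs, a plain copy of it is the head; removing that copy stays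
  within the family, as further plain copies may follow.\<close>

lemma overpartitions_plain_rec:
  "overpartitions_plain (Suc M) n = overpartitions_le M n \<union>
     (if Suc M \<le> n then Cons (Suc M, False) ` overpartitions_plain (Suc M) (n - Suc M) else {})"
  (is "?L = ?R")
proof (rule set_eqI)
  fix xs :: "(nat \<times> bool) list"
  show "xs \<in> ?L \<longleftrightarrow> xs \<in> ?R"
  proof (cases xs)
    case Nil
    then show ?thesis
      by (auto simp: overpartitions_plain_def Nil_in_overpartitions_le_iff)
  next
    case (Cons x ys)
    then show ?thesis
      by (cases x) (auto simp: overpartitions_plain_def Cons_in_overpartitions_le_iff le_Suc_eq
                         dest: overpartitions_le_not_mem)
  qed
qed

text \<open>An overlined \<open>Suc M\<close> is the head of the list, and only plain copies of
  \<open>Suc M\<close> may follow it.\<close>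

lemma overpartitions_le_rec:
  "overpartitions_le (Suc M) n = overpartitions_plain (Suc M) n \<union>
     (if Suc M \<le> n then Cons (Suc M, True) ` overpartitions_plain (Suc M) (n - Suc M) else {})"
  (is "?L = ?R")
proof (rule set_eqI)
  fix xs :: "(nat \<times> bool) list"
  show "xs \<in> ?L \<longleftrightarrow> xs \<in> ?R"
  proof (cases xs)
    case Nil
    then show ?thesis
      by (auto simp: overpartitions_plain_def Nil_in_overpartitions_le_iff)
  next
    case (Cons x ys)
    then show ?thesis
      by (cases x) (auto simp: overpartitions_plain_def Cons_in_overpartitions_le_iff le_Suc_eq
                         dest: overpartitions_le_not_mem)
  qed
qed

definition overpartitions_le_fps :: "nat \<Rightarrow> rat fps" where
  "overpartitions_le_fps M = Abs_fps (\<lambda>n. of_nat (card (overpartitions_le M n)))"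

text \<open>Writing P_M for \<open>overpartitions_le_fps M\<close>, the two recursions give (1 -
  q^(M+1)) U = P_M and P_(M+1) = (1 + q^(M+1)) U; then U is eliminated.\<close>

lemma overpartitions_le_fps_Suc:
  "(1 - fps_X ^ Suc M) * overpartitions_le_fps (Suc M) = (1 + fps_X ^ Suc M) * overpartitions_le_fps M"
proof -
  define U :: "rat fps" where "U = Abs_fps (\<lambda>n. of_nat (card (overpartitions_plain (Suc M) n)))"
  have "card (overpartitions_plain (Suc M) n) = card (overpartitions_le M n) +
          (if Suc M \<le> n then card (overpartitions_plain (Suc M) (n - Suc M)) else 0)" for n
  proof (cases "Suc M \<le> n")
    case True
    have "overpartitions_le M n \<inter> Cons (Suc M, False) ` overpartitions_plain (Suc M) (n - Suc M) = {}"
      by (auto simp: overpartitions_le_def)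
    with True show ?thesis
      by (subst overpartitions_plain_rec)
         (simp add: card_Un_disjoint card_image finite_overpartitions_le finite_overpartitions_plain)
  qed (subst overpartitions_plain_rec, simp)
  then have "U = overpartitions_le_fps M + fps_X ^ Suc M * U"
    by (auto simp: fps_eq_iff U_def overpartitions_le_fps_def fps_X_power_mult_nth simp del: power_Suc)
  then have 1: "(1 - fps_X ^ Suc M) * U = overpartitions_le_fps M"
    by (simp add: algebra_simps)
  have "card (overpartitions_le (Suc M) n) = card (overpartitions_plain (Suc M) n) +
          (if Suc M \<le> n then card (overpartitions_plain (Suc M) (n - Suc M)) else 0)" for n
  proof (cases "Suc M \<le> n")
    case True
    have "overpartitions_plain (Suc M) n \<inter> Cons (Suc M, True) ` overpartitions_plain (Suc M) (n - Suc M) = {}"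
      by (auto simp: overpartitions_plain_def)
    with True show ?thesis
      by (subst overpartitions_le_rec)
         (simp add: card_Un_disjoint card_image finite_overpartitions_plain)
  qed (subst overpartitions_le_rec, simp)
  then have 2: "overpartitions_le_fps (Suc M) = (1 + fps_X ^ Suc M) * U"
    by (auto simp: fps_eq_iff U_def overpartitions_le_fps_def fps_X_power_mult_nth ring_distribs
             simp del: power_Suc)
  show ?thesis
    unfolding 1[symmetric] 2 by (simp only: mult_ac)
qed

lemma overpartitions_le_fps_mult_minus_poch: "overpartitions_le_fps M * minus_poch M = plus_poch M"
proof (induction M)
  case 0
  have "overpartitions_le 0 n = (if n = 0 then {[]} else {})" for n
  proof -
    have "xs \<in> overpartitions_le 0 n \<longleftrightarrow> xs = [] \<and> n = 0" for xs
      by (cases xs) (auto simp: overpartitions_le_def Cons_in_overpartitions_iff Nil_in_overpartitions_iff)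
    then show ?thesis
      by auto
  qed
  then have "overpartitions_le_fps 0 = 1"
    by (simp add: overpartitions_le_fps_def fps_eq_iff)
  then show ?case
    by (simp add: minus_poch_def plus_poch_def)
next
  case (Suc M)
  have "overpartitions_le_fps (Suc M) * minus_poch (Suc M) =
          ((1 - fps_X ^ Suc M) * overpartitions_le_fps (Suc M)) * minus_poch M"
    by (simp add: minus_poch_def mult_ac del: power_Suc)
  also have "\<dots> = (1 + fps_X ^ Suc M) * (overpartitions_le_fps M * minus_poch M)"
    by (simp only: overpartitions_le_fps_Suc mult.assoc)
  also have "\<dots> = plus_poch (Suc M)"
    unfolding Suc by (simp add: plus_poch_def mult.commute del: power_Suc)
  finally show ?case .
qed

lemma overpartitions_le_fps_LIMSEQ:
  "overpartitions_le_fps \<longlonglongrightarrow> Abs_fps (\<lambda>n. of_nat (overpartition_number n))"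
proof (intro tendsto_fpsI eventually_sequentiallyI)
  fix n M :: nat
  assume "n \<le> M"
  then have "overpartitions_le M n = overpartitions n"
    using overpartition_part_le by (force simp: overpartitions_le_def)
  then show "fps_nth (overpartitions_le_fps M) n =
      fps_nth (Abs_fps (\<lambda>n. of_nat (overpartition_number n))) n"
    by (simp add: overpartitions_le_fps_def overpartition_number_def)
qed

text \<open>In the limit the generating function times (q;q) is (-q;q), and Euler's identity turns a
  further factor (q;q^2) into 1.\<close>

lemma overpartition_fps:
  "Abs_fps (\<lambda>n. of_nat (overpartition_number n)) *
     (qpoch_inf (fps_X ^ 2) (fps_X ^ 2) * (qpoch_inf fps_X (fps_X ^ 2)) ^ 2) = 1"
proof -
  let ?P = "Abs_fps (\<lambda>n. of_nat (overpartition_number n)) :: rat fps"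
  let ?b = "qpoch_inf fps_X (fps_X ^ 2)"
  have "plus_poch \<longlonglongrightarrow> ?P * qpoch_inf fps_X fps_X"
    using tendsto_mult_fps[OF overpartitions_le_fps_LIMSEQ minus_poch_LIMSEQ]
    by (simp add: overpartitions_le_fps_mult_minus_poch)
  then have "?P * qpoch_inf fps_X fps_X = qpoch_inf (- fps_X) fps_X"
    using plus_poch_LIMSEQ LIMSEQ_unique by blast
  then have "?P * qpoch_inf fps_X fps_X * ?b = 1"
    using qpoch_inf_odd_plus by (simp add: mult.commute)
  then show ?thesis
    by (simp add: qpoch_inf_X power2_eq_square mult.assoc)
qed

subsection \<open>Truncated MacMahon series\<close>

text \<open>The series x_t whose elementary symmetric functions are the C_k.\<close>

definition macmahon_weight :: "nat \<Rightarrow> rat fps" where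
  "macmahon_weight t = fps_X ^ (2 * t - 1) * inverse ((1 - fps_X ^ (2 * t - 1))\<^sup>2)"

text \<open>All entries are positive, so the truncated subtraction of \<open>k\<close> distributes
  over the sum; the denominator has constant term 1, so division is multiplication by its
  inverse.\<close>

lemma macmahon_C_term_eq_prod:
  assumes "s \<in> increasing_tuples k"
  shows "macmahon_C_term k s = (\<Prod>i<k. macmahon_weight (s ! i))"
proof -
  have pos: "0 < s ! i" if "i < k" for i
    using assms that by (auto simp: increasing_tuples_def)
  have "(\<Sum>i<k. 2 * s ! i - 1) = (\<Sum>i<k. 2 * s ! i) - (\<Sum>i<k. 1)"
    by (rule sum_subtractf_nat) (use pos in \<open>force\<close>)
  then have "macmahon_C_term k s =
      fps_X ^ (\<Sum>i<k. 2 * s ! i - 1) / (\<Prod>i<k. (1 - fps_X ^ (2 * s ! i - 1))\<^sup>2)"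
    by (simp add: macmahon_C_term_def)
  also have "fps_nth (\<Prod>i<k. (1 - fps_X ^ (2 * s ! i - 1))\<^sup>2 :: rat fps) 0 = 1"
    unfolding fps_nth_0_prod
  proof (intro prod.neutral ballI)
    fix i
    assume "i \<in> {..<k}"
    then have "2 * s ! i - 1 \<noteq> 0"
      using pos[of i] by simp
    then show "fps_nth ((1 - fps_X ^ (2 * s ! i - 1))\<^sup>2 :: rat fps) 0 = 1"
      by (simp add: power2_eq_square)
  qed
  then have "fps_X ^ (\<Sum>i<k. 2 * s ! i - 1) / (\<Prod>i<k. (1 - fps_X ^ (2 * s ! i - 1))\<^sup>2) =
      (\<Prod>i<k. macmahon_weight (s ! i))"
    by (simp add: fps_divide_unit macmahon_weight_def prod.distrib power_sum inverse_prod_fps)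
  finally show ?thesis .
qed

lemma macmahon_C_term_nth_eq_0:
  assumes "s \<in> increasing_tuples k" "n < (\<Sum>i<k. 2 * s ! i - 1)"
  shows "fps_nth (macmahon_C_term k s) n = 0"
  using assms
  by (simp add: macmahon_C_term_eq_prod macmahon_weight_def prod.distrib fps_X_power_mult_nth
           flip: power_sum)

section \<open>Lower bounds for the exponents in C_k\<close>

lemma increasing_tuples_nth_ge:
  assumes "s \<in> increasing_tuples k" "i < k"
  shows "Suc i \<le> s ! i"
  using assms(2)
proof (induction i)
  case 0
  then show ?case
    using assms(1) by (auto simp: increasing_tuples_def Suc_le_eq)
next
  case (Suc i)
  then have "s ! i < s ! Suc i"
    using assms(1) by (auto simp: increasing_tuples_def sorted_wrt_nth_less)
  with Suc show ?case
    by simp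
qed

text \<open>The entries dominate 1, 2, ..., k, and 1 + 3 + ... + (2k - 1) = k^2. This is the source
  of C_k = O(q^(k^2)).\<close>

lemma square_le_tuple_weight:
  assumes "s \<in> increasing_tuples k"
  shows "k\<^sup>2 \<le> (\<Sum>i<k. 2 * s ! i - 1)"
proof -
  have "k\<^sup>2 = (\<Sum>i<k. 2 * i + 1)"
    by (induction k) (auto simp: power2_eq_square)
  also have "\<dots> \<le> (\<Sum>i<k. 2 * s ! i - 1)"
    using increasing_tuples_nth_ge[OF assms] by (intro sum_mono) fastforce
  finally show ?thesis .
qed

text \<open>Since t <= 2t - 1 for positive t, only tuples with entries at most n contribute to the
  coefficient of q^n.\<close>

lemma entry_le_tuple_weight:
  assumes "s \<in> increasing_tuples k" "t \<in> set s"
  shows "t \<le> (\<Sum>i<k. 2 * s ! i - 1)"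
proof -
  obtain i where i: "i < k" "t = s ! i"
    using assms by (auto simp: increasing_tuples_def in_set_conv_nth)
  then have "2 * s ! i - 1 \<le> (\<Sum>i<k. 2 * s ! i - 1)"
    by (intro member_le_sum) auto
  with i increasing_tuples_nth_ge[OF assms(1) i(1)] show ?thesis
    by linarith
qed

definition bounded_tuples :: "nat \<Rightarrow> nat \<Rightarrow> nat list set" where
  "bounded_tuples N k = {s \<in> increasing_tuples k. set s \<subseteq> {..N}}"

text \<open>The k-th elementary symmetric polynomial in x_1, ..., x_N.\<close>

definition macmahon_trunc :: "nat \<Rightarrow> nat \<Rightarrow> rat fps" where
  "macmahon_trunc N k = sum (macmahon_C_term k) (bounded_tuples N k)"

lemma finite_bounded_tuples: "finite (bounded_tuples N k)"
  by (rule finite_subset[OF _ finite_lists_length_eq[of "{..N}" k]])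
     (auto simp: bounded_tuples_def increasing_tuples_def)

lemma m_odd_eq_macmahon_trunc:
  assumes "n \<le> N"
  shows "m_odd k n = fps_nth (macmahon_trunc N k) n"
proof -
  have "(macmahon_C_term k has_sum macmahon_C k) (increasing_tuples k)"
    unfolding macmahon_C_def by (rule has_sum_infsum[OF summable_macmahon_C])
  then have "m_odd k n = (\<Sum>s | s \<in> increasing_tuples k \<and> fps_nth (macmahon_C_term k s) n \<noteq> 0.
      fps_nth (macmahon_C_term k s) n)"
    unfolding m_odd_def by (rule has_sum_fpsD(2))
  also have "\<dots> = (\<Sum>s\<in>bounded_tuples N k. fps_nth (macmahon_C_term k s) n)"
  proof (rule sum.mono_neutral_left[OF finite_bounded_tuples])
    show "{s \<in> increasing_tuples k. fps_nth (macmahon_C_term k s) n \<noteq> 0} \<subseteq> bounded_tuples N k"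
    proof safe
      fix s
      assume s: "s \<in> increasing_tuples k" "fps_nth (macmahon_C_term k s) n \<noteq> 0"
      then have "(\<Sum>i<k. 2 * s ! i - 1) \<le> n"
        using macmahon_C_term_nth_eq_0 not_le by blast
      then show "s \<in> bounded_tuples N k"
        using entry_le_tuple_weight[OF s(1)] s(1) assms by (force simp: bounded_tuples_def)
    qed
  qed (auto simp: bounded_tuples_def)
  finally show ?thesis
    by (simp add: macmahon_trunc_def fps_sum_nth)
qed

lemma m_odd_eq_0:
  assumes "n < k\<^sup>2"
  shows "m_odd k n = 0"
  unfolding m_odd_eq_macmahon_trunc[OF order_refl] macmahon_trunc_def fps_sum_nth
  using assms square_le_tuple_weight
  by (intro sum.neutral ballI macmahon_C_term_nth_eq_0)
     (auto simp: bounded_tuples_def intro: less_le_trans)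

lemma macmahon_trunc_0_right: "macmahon_trunc N 0 = 1"
proof -
  have "bounded_tuples N 0 = {[]}"
    by (auto simp: bounded_tuples_def increasing_tuples_def)
  then show ?thesis
    by (simp add: macmahon_trunc_def macmahon_C_term_def)
qed

lemma macmahon_trunc_0_Suc: "macmahon_trunc 0 (Suc k) = 0"
proof -
  have "bounded_tuples 0 (Suc k) = {}"
    by (auto simp: bounded_tuples_def increasing_tuples_def length_Suc_conv)
  then show ?thesis
    by (simp add: macmahon_trunc_def)
qed

lemma snoc_in_bounded_tuples_iff:
  "s @ [t] \<in> bounded_tuples N (Suc k) \<longleftrightarrow> 0 < t \<and> t \<le> N \<and> s \<in> bounded_tuples (t - 1) k"
  by (auto simp: bounded_tuples_def increasing_tuples_def sorted_wrt_append subset_iff)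

text \<open>The last entry is the largest, so it alone decides whether the bound
  \<open>Suc N\<close> is attained.\<close>

lemma bounded_tuples_Suc_Suc:
  "bounded_tuples (Suc N) (Suc k) =
     bounded_tuples N (Suc k) \<union> (\<lambda>s. s @ [Suc N]) ` bounded_tuples N k"
proof (rule set_eqI)
  fix s
  show "s \<in> bounded_tuples (Suc N) (Suc k) \<longleftrightarrow>
      s \<in> bounded_tuples N (Suc k) \<union> (\<lambda>s. s @ [Suc N]) ` bounded_tuples N k"
  proof (cases s rule: rev_cases)
    case Nil
    then show ?thesis
      by (auto simp: bounded_tuples_def increasing_tuples_def)
  next
    case (snoc ys y)
    then show ?thesis
      by (auto simp: snoc_in_bounded_tuples_iff le_Suc_eq)
  qed
qed

lemma macmahon_trunc_Suc_Suc:
  "macmahon_trunc (Suc N) (Suc k) =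
     macmahon_trunc N (Suc k) + macmahon_weight (Suc N) * macmahon_trunc N k"
proof -
  have term_snoc: "macmahon_C_term (Suc k) (s @ [Suc N]) =
      macmahon_weight (Suc N) * macmahon_C_term k s" if "s \<in> bounded_tuples N k" for s
  proof -
    have s: "s \<in> increasing_tuples k" "length s = k"
      using that by (auto simp: bounded_tuples_def increasing_tuples_def)
    have "s @ [Suc N] \<in> increasing_tuples (Suc k)"
      using that by (force simp: bounded_tuples_def increasing_tuples_def sorted_wrt_append)
    then show ?thesis
      using s by (simp add: macmahon_C_term_eq_prod nth_append mult.commute)
  qed
  have "bounded_tuples N (Suc k) \<inter> (\<lambda>s. s @ [Suc N]) ` bounded_tuples N k = {}"
    by (auto simp: bounded_tuples_def)
  then have "macmahon_trunc (Suc N) (Suc k) = macmahon_trunc N (Suc k) +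
      sum (macmahon_C_term (Suc k)) ((\<lambda>s. s @ [Suc N]) ` bounded_tuples N k)"
    unfolding macmahon_trunc_def bounded_tuples_Suc_Suc
    by (intro sum.union_disjoint) (auto simp: finite_bounded_tuples)
  also have "sum (macmahon_C_term (Suc k)) ((\<lambda>s. s @ [Suc N]) ` bounded_tuples N k) =
      macmahon_weight (Suc N) * macmahon_trunc N k"
    by (simp add: sum.reindex inj_on_def term_snoc macmahon_trunc_def sum_distrib_left)
  finally show ?thesis .
qed

lemma macmahon_trunc_eq_0: "N < k \<Longrightarrow> macmahon_trunc N k = 0"
proof (induction N arbitrary: k)
  case 0
  then show ?case
    by (cases k) (auto simp: macmahon_trunc_0_Suc)
next
  case (Suc N)
  then show ?case
    by (cases k) (auto simp: macmahon_trunc_Suc_Suc)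
qed

subsection \<open>A finite form of the Jacobi triple product\<close>

text \<open>The coefficient of $z^k$ in $(z + 2 + z^{-1})^m = (1+z)^{2m} z^{-m}$.\<close>

definition shifted_binomial :: "nat \<Rightarrow> int \<Rightarrow> rat fps" where
  "shifted_binomial m k = (if int m + k < 0 then 0 else of_nat ((2 * m) choose nat (int m + k)))"

text \<open>One more factor z + 2 + 1/z, that is, Pascal's rule applied twice.\<close>

lemma shifted_binomial_Suc:
  "shifted_binomial (Suc m) k =
     shifted_binomial m (k - 1) + 2 * shifted_binomial m k + shifted_binomial m (k + 1)"
proof -
  \<comment> \<open>Pascal's rule for natural lower indices covers only the last case; in the others
    the value 0 at negative lower indices enters.\<close>
  consider "int m + k < -1" | "k = -1 - int m" | "k = - int m" | p where "int m + k = int (Suc p)"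
  proof (cases "int m + k > 0")
    case True
    then have "int m + k = int (Suc (nat (int m + k - 1)))"
      by linarith
    then show ?thesis
      using that by blast
  next
    case False
    then show ?thesis
      using that by linarith
  qed
  then show ?thesis
  proof cases
    case 4
    then have "nat (int m + k) = Suc p" "nat (int (Suc m) + k) = Suc (Suc p)"
      "nat (int m + (k - 1)) = p" "nat (int m + (k + 1)) = Suc (Suc p)"
      "\<not> int m + k < 0" "\<not> int (Suc m) + k < 0" "\<not> int m + (k - 1) < 0" "\<not> int m + (k + 1) < 0"
      by linarith+
    then show ?thesis
      by (simp add: shifted_binomial_def)
  qed (simp_all add: shifted_binomial_def)
qed

text \<open>The coefficient of z^k in the product of the factors 1 + (z + 2 + 1/z) x_i over i <=
  N.\<close>

definition macmahon_sum :: "nat \<Rightarrow> int \<Rightarrow> rat fps" where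
  "macmahon_sum N k = (\<Sum>m\<le>N. shifted_binomial m k * macmahon_trunc N m)"

text \<open>The effect on coefficients of the new factor 1 + (z + 2 + 1/z) x_(N+1).\<close>

lemma macmahon_sum_Suc:
  "macmahon_sum (Suc N) k = macmahon_sum N k + macmahon_weight (Suc N) *
     (macmahon_sum N (k - 1) + 2 * macmahon_sum N k + macmahon_sum N (k + 1))"
proof -
  have "macmahon_sum (Suc N) k = shifted_binomial 0 k +
      (\<Sum>m\<le>N. shifted_binomial (Suc m) k *
         (macmahon_trunc N (Suc m) + macmahon_weight (Suc N) * macmahon_trunc N m))"
    unfolding macmahon_sum_def
    by (subst sum.atMost_Suc_shift) (simp add: macmahon_trunc_0_right macmahon_trunc_Suc_Suc)
  also have "\<dots> = shifted_binomial 0 k +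
      (\<Sum>m\<le>N. shifted_binomial (Suc m) k * macmahon_trunc N (Suc m)) +
      macmahon_weight (Suc N) * (\<Sum>m\<le>N. shifted_binomial (Suc m) k * macmahon_trunc N m)"
    by (simp add: ring_distribs sum.distrib sum_distrib_left mult_ac)
  also have "shifted_binomial 0 k + (\<Sum>m\<le>N. shifted_binomial (Suc m) k * macmahon_trunc N (Suc m)) =
      (\<Sum>m\<le>Suc N. shifted_binomial m k * macmahon_trunc N m)"
    by (subst sum.atMost_Suc_shift) (simp add: macmahon_trunc_0_right)
  \<comment> \<open>The additional term m = N + 1 vanishes: N variables have no elementary symmetric
    polynomial of degree N + 1.\<close>
  also have "\<dots> = macmahon_sum N k"
    by (simp add: macmahon_sum_def macmahon_trunc_eq_0)
  also have "(\<Sum>m\<le>N. shifted_binomial (Suc m) k * macmahon_trunc N m) =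
      macmahon_sum N (k - 1) + 2 * macmahon_sum N k + macmahon_sum N (k + 1)"
    by (simp add: macmahon_sum_def shifted_binomial_Suc ring_distribs sum.distrib sum_distrib_left
          mult.assoc)
  finally show ?thesis .
qed

text \<open>
  The convention $1/(q^2;q^2)_i = 0$ for $i < 0$ makes the recurrences below hold at the boundary
  $|k| = N$ without case distinctions.
\<close>

definition inv_even_poch :: "int \<Rightarrow> rat fps" where
  "inv_even_poch i = (if i < 0 then 0 else inverse (even_poch (nat i)))"

text \<open>For a = 0 the left side is 0 by convention and the factor on the right is 1 - 1.\<close>

lemma inv_even_poch_minus_1:
  "inv_even_poch (int a - 1) = (1 - fps_X ^ (2 * a)) * inv_even_poch (int a)"
proof (cases a)
  case (Suc a')
  have "inverse (1 - fps_X ^ (2 * a)) * (1 - fps_X ^ (2 * a)) = (1 :: rat fps)"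
    by (rule inverse_mult_eq_1) (simp add: Suc)
  then have "(1 - fps_X ^ (2 * a)) * inverse (1 - fps_X ^ (2 * a)) = (1 :: rat fps)"
    by (simp add: mult.commute)
  moreover have "even_poch a = even_poch a' * (1 - fps_X ^ (2 * a))"
    by (simp add: even_poch_def Suc)
  ultimately show ?thesis
    by (simp add: inv_even_poch_def fps_inverse_mult) (simp add: Suc mult_ac)
qed (simp add: inv_even_poch_def)

text \<open>The factor q^2 replaces 1 - q^(2a-2) by q^2 - q^(2a), avoiding a negative exponent at a
  = 0. The right side vanishes at a = 0 and a = 1, as the convention demands.\<close>

lemma inv_even_poch_minus_2:
  "fps_X ^ 2 * inv_even_poch (int a - 2) =
     (fps_X ^ 2 - fps_X ^ (2 * a)) * (1 - fps_X ^ (2 * a)) * inv_even_poch (int a)"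
proof (cases a)
  case (Suc a')
  have "inv_even_poch (int a - 2) = inv_even_poch (int a' - 1)"
    by (simp add: Suc)
  also have "\<dots> = (1 - fps_X ^ (2 * a')) * inv_even_poch (int a')"
    by (rule inv_even_poch_minus_1)
  also have "inv_even_poch (int a') = (1 - fps_X ^ (2 * a)) * inv_even_poch (int a)"
    using inv_even_poch_minus_1[of a] by (simp add: Suc)
  finally have "inv_even_poch (int a - 2) =
      (1 - fps_X ^ (2 * a')) * (1 - fps_X ^ (2 * a)) * inv_even_poch (int a)"
    by (simp only: mult.assoc)
  moreover have "fps_X ^ (2 * a) = (fps_X ^ 2 * fps_X ^ (2 * a') :: rat fps)"
    by (simp add: Suc flip: power_add)
  ultimately show ?thesis
    by (simp only:) (simp only: right_diff_distrib left_diff_distrib mult_1_right mult_1_left mult.assoc)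
qed (simp add: inv_even_poch_def)

text \<open>
  The coefficient of $z^k$ in $\prod_{i=1}^{N} (1+zq^{2i-1})(1+z^{-1}q^{2i-1})$, which is $q^{k^2}$
  times the Gaussian binomial coefficient of $2N$ over $N+k$ to the base $q^2$.
\<close>

definition triple_coeff :: "nat \<Rightarrow> int \<Rightarrow> rat fps" where
  "triple_coeff N k =
     fps_X ^ nat (k\<^sup>2) * even_poch (2 * N) * inv_even_poch (int N - k) * inv_even_poch (int N + k)"

text \<open>The algebraic core of the recurrence below: without the common factor K * E * a * b it
  is a polynomial identity in A, B, Q.\<close>

lemma triple_coeff_identity:
  fixes A B Q K E a b :: "'a :: comm_ring_1"
  shows "K * (E * (Q - A * B) * (1 - A * B)) * a * b =
    (Q + A * B) * (K * E * (1 - A) * a * (1 - B) * b) +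
    K * A * E * a * (Q - B) * (1 - B) * b + K * B * E * b * (Q - A) * (1 - A) * a"
proof -
  have "(Q - A * B) * (1 - A * B) =
      (Q + A * B) * (1 - A) * (1 - B) + A * (Q - B) * (1 - B) + B * (Q - A) * (1 - A)"
    by (simp add: ring_distribs mult_ac)
  moreover have "K * (E * (Q - A * B) * (1 - A * B)) * a * b =
      K * E * a * b * ((Q - A * B) * (1 - A * B))"
    by (simp only: mult_ac)
  ultimately show ?thesis
    by (simp only: distrib_left distrib_right mult_ac add_ac)
qed

text \<open>With y = q^(2N+1), this is multiplication by (1 + zy)(1 + y/z) = 1 + y^2 + y(z + 1/z).
  It is verified on the closed form: all terms are expressed by \<open>inv_even_poch\<close> at a =
  N + 1 - k and b = N + 1 + k, after multiplying by q^2.\<close>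

lemma triple_coeff_Suc:
  "triple_coeff (Suc N) k = (1 + (fps_X ^ (2 * N + 1))\<^sup>2) * triple_coeff N k +
     fps_X ^ (2 * N + 1) * (triple_coeff N (k - 1) + triple_coeff N (k + 1))"
\<comment> \<open>Beyond this range every term contains an \<open>inv_even_poch\<close> at a
  negative argument and vanishes; within it, a and b are natural numbers.\<close>
proof (cases "\<bar>k\<bar> > int N + 1")
  case True
  then show ?thesis
    by (auto simp: triple_coeff_def inv_even_poch_def)
next
  case False
  define a b where "a = nat (int N + 1 - k)" and "b = nat (int N + 1 + k)"
  have a: "int a = int N + 1 - k" and b: "int b = int N + 1 + k"
    using False by (auto simp: a_def b_def)
  define A B Q K E y :: "rat fps"
    where "A = fps_X ^ (2 * a)" and "B = fps_X ^ (2 * b)" and "Q = fps_X ^ 2"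
      and "K = fps_X ^ nat (k\<^sup>2)" and "E = even_poch (2 * N)" and "y = fps_X ^ (2 * N + 1)"
  define ra rb where "ra = inv_even_poch (int a)" and "rb = inv_even_poch (int b)"
  have ab: "a + b = 2 * N + 2"
    using a b by linarith
  have AB: "A * B = fps_X ^ (4 * N + 4)"
    using ab unfolding A_def B_def power_add[symmetric] by (intro arg_cong[of _ _ "power fps_X"]) linarith
  have Qy: "Q * y\<^sup>2 = A * B"
    unfolding AB Q_def y_def power_mult[symmetric] power_add[symmetric]
    by (intro arg_cong[of _ _ "power fps_X"]) simp
  \<comment> \<open>Completing squares: (k - 1)^2 + 2N + 1 = k^2 + 2a and (k + 1)^2 + 2N + 1 = k^2 +
    2b.\<close>
  have yK: "y * fps_X ^ nat ((k - 1)\<^sup>2) = K * A" "y * fps_X ^ nat ((k + 1)\<^sup>2) = K * B"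
  proof -
    have sq: "int (nat (z\<^sup>2)) = z * z" for z
      by (simp add: power2_eq_square)
    have "2 * N + 1 + nat ((k - 1)\<^sup>2) = nat (k\<^sup>2) + 2 * a"
      "2 * N + 1 + nat ((k + 1)\<^sup>2) = nat (k\<^sup>2) + 2 * b"
      unfolding of_nat_eq_iff[where 'a = int, symmetric] of_nat_add sq
      using a b by (simp_all add: algebra_simps)
    then show "y * fps_X ^ nat ((k - 1)\<^sup>2) = K * A" "y * fps_X ^ nat ((k + 1)\<^sup>2) = K * B"
      unfolding y_def K_def A_def B_def power_add[symmetric] by (simp_all only:)
  qed
  \<comment> \<open>Since A * B = q^(4N+4), the factor Q turns 1 - q^(4N+2) into Q - A * B.\<close>
  have E: "Q * even_poch (2 * Suc N) = E * (Q - A * B) * (1 - A * B)"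
  proof -
    define z :: "rat fps" where "z = fps_X ^ (4 * N + 2)"
    have "2 * Suc N = Suc (Suc (2 * N))" "2 * (2 * N) + 2 = 4 * N + 2" "2 * Suc (2 * N) + 2 = 4 * N + 4"
      by simp_all
    then have 1: "even_poch (2 * Suc N) = E * (1 - z) * (1 - A * B)"
      unfolding even_poch_def E_def z_def AB by (simp only: prod.lessThan_Suc)
    have 2: "A * B = Q * z"
      unfolding AB Q_def z_def power_add[symmetric] by (intro arg_cong[of _ _ "power fps_X"]) linarith
    show ?thesis
      unfolding 1 unfolding 2 by (simp add: algebra_simps)
  qed
  have F0: "triple_coeff N k = K * E * (1 - A) * ra * (1 - B) * rb"
  proof -
    have "int N - k = int a - 1" "int N + k = int b - 1"
      using a b by auto
    then show ?thesis
      unfolding triple_coeff_def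
      by (simp only: K_def E_def A_def B_def ra_def rb_def inv_even_poch_minus_1 mult_ac)
  qed
  have Qr: "Q * inv_even_poch (int a - 2) = (Q - A) * (1 - A) * ra"
    "Q * inv_even_poch (int b - 2) = (Q - B) * (1 - B) * rb"
    unfolding Q_def A_def B_def ra_def rb_def by (rule inv_even_poch_minus_2)+
  have F1: "Q * (y * triple_coeff N (k - 1)) = K * A * E * ra * (Q - B) * (1 - B) * rb"
  proof -
    have "int N - (k - 1) = int a" "int N + (k - 1) = int b - 2"
      using a b by auto
    then have "Q * (y * triple_coeff N (k - 1)) =
        (y * fps_X ^ nat ((k - 1)\<^sup>2)) * E * ra * (Q * inv_even_poch (int b - 2))"
      unfolding triple_coeff_def by (simp only: E_def ra_def mult_ac)
    then show ?thesis
      unfolding yK Qr by (simp only: mult_ac)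
  qed
  have F2: "Q * (y * triple_coeff N (k + 1)) = K * B * E * rb * (Q - A) * (1 - A) * ra"
  proof -
    have "int N + (k + 1) = int b" "int N - (k + 1) = int a - 2"
      using a b by auto
    then have "Q * (y * triple_coeff N (k + 1)) =
        (y * fps_X ^ nat ((k + 1)\<^sup>2)) * E * rb * (Q * inv_even_poch (int a - 2))"
      unfolding triple_coeff_def by (simp only: E_def rb_def mult_ac)
    then show ?thesis
      unfolding yK Qr by (simp only: mult_ac)
  qed
  have "Q * triple_coeff (Suc N) k = K * (Q * even_poch (2 * Suc N)) * ra * rb"
  proof -
    have "int (Suc N) - k = int a" "int (Suc N) + k = int b"
      using a b by auto
    then show ?thesis
      unfolding triple_coeff_def by (simp only: K_def ra_def rb_def mult_ac)
  qed
  also have "\<dots> = (Q + Q * y\<^sup>2) * triple_coeff N k +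
      Q * (y * triple_coeff N (k - 1)) + Q * (y * triple_coeff N (k + 1))"
    unfolding E F0 F1 F2 Qy by (rule triple_coeff_identity)
  also have "\<dots> = Q * ((1 + y\<^sup>2) * triple_coeff N k + y * (triple_coeff N (k - 1) + triple_coeff N (k + 1)))"
    by (simp add: algebra_simps)
  finally show ?thesis
    unfolding y_def[symmetric] by (rule mult_left_cancel[THEN iffD1, rotated]) (simp add: Q_def)
qed

text \<open>Both sides are 1 at N = 0, k = 0 and 0 at N = 0 for other k, and both satisfy the
  recurrence of \<open>triple_coeff\<close>; \<open>k\<close> varies because the recurrence involves
  its neighbours.\<close>

lemma macmahon_sum_eq_triple_coeff: "(odd_poch N)\<^sup>2 * macmahon_sum N k = triple_coeff N k"
proof (induction N arbitrary: k)
  case 0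
  have "triple_coeff 0 k = shifted_binomial 0 k"
    by (cases "k = 0")
       (auto simp: triple_coeff_def shifted_binomial_def inv_even_poch_def even_poch_def)
  then show ?case
    by (simp add: odd_poch_def macmahon_sum_def macmahon_trunc_0_right)
next
  case (Suc N)
  define y :: "rat fps" where "y = fps_X ^ (2 * N + 1)"
  have w: "(1 - y)\<^sup>2 * macmahon_weight (Suc N) = y"
  proof -
    have "(1 - y)\<^sup>2 * inverse ((1 - y)\<^sup>2) = 1"
      by (rule inverse_mult_eq_1') (simp add: y_def power2_eq_square)
    moreover have "macmahon_weight (Suc N) = y * inverse ((1 - y)\<^sup>2)"
      by (simp add: macmahon_weight_def y_def)
    ultimately show ?thesis
      by (simp add: mult.left_commute)
  qed
  have "(odd_poch (Suc N))\<^sup>2 * macmahon_sum (Suc N) k =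
      (odd_poch N)\<^sup>2 * ((1 - y)\<^sup>2 * macmahon_sum (Suc N) k)"
    by (simp add: odd_poch_def y_def power_mult_distrib)
  also have "(1 - y)\<^sup>2 * macmahon_sum (Suc N) k = (1 - y)\<^sup>2 * macmahon_sum N k +
      ((1 - y)\<^sup>2 * macmahon_weight (Suc N)) *
      (macmahon_sum N (k - 1) + 2 * macmahon_sum N k + macmahon_sum N (k + 1))"
    unfolding macmahon_sum_Suc by (simp only: distrib_left mult.assoc)
  also have "(odd_poch N)\<^sup>2 * \<dots> = (1 + y\<^sup>2) * ((odd_poch N)\<^sup>2 * macmahon_sum N k) +
      y * ((odd_poch N)\<^sup>2 * macmahon_sum N (k - 1) + (odd_poch N)\<^sup>2 * macmahon_sum N (k + 1))"
  proof -
    \<comment> \<open>The middle coefficient is (1 - y)^2 + 2y = 1 + y^2.\<close>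
    have "d * ((1 - y)\<^sup>2 * c + y * (l + 2 * c + r)) = (1 + y\<^sup>2) * (d * c) + y * (d * l + d * r)"
      for d c l r :: "rat fps"
      by (simp add: power2_eq_square algebra_simps)
    then show ?thesis
      unfolding w .
  qed
  finally show ?case
    unfolding Suc by (simp only: triple_coeff_Suc y_def)
qed

subsection \<open>The limit\<close>

text \<open>The infinite sum of binomial(2m, m+k) C_m, given by its coefficients: as C_m =
  O(q^(m^2)), only m <= n contributes to q^n.\<close>

definition macmahon_sum_inf :: "nat \<Rightarrow> rat fps" where
  "macmahon_sum_inf k = Abs_fps (\<lambda>n. \<Sum>m\<le>n. of_nat ((2 * m) choose (m + k)) * m_odd m n)"

lemma macmahon_sum_LIMSEQ: "(\<lambda>N. macmahon_sum N (int k)) \<longlonglongrightarrow> macmahon_sum_inf k"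
proof (intro tendsto_fpsI eventually_sequentiallyI)
  fix n N :: nat
  assume n: "n \<le> N"
  have "shifted_binomial m (int k) = of_nat ((2 * m) choose (m + k))" for m
    by (simp add: shifted_binomial_def flip: of_nat_add)
  then have "fps_nth (macmahon_sum N (int k)) n =
      (\<Sum>m\<le>N. of_nat ((2 * m) choose (m + k)) * m_odd m n)"
    by (simp add: macmahon_sum_def fps_sum_nth m_odd_eq_macmahon_trunc[OF n])
  also have "\<dots> = (\<Sum>m\<le>n. of_nat ((2 * m) choose (m + k)) * m_odd m n)"
  proof (rule sum.mono_neutral_right)
    have "n < m\<^sup>2" if "n < m" for m
      using that self_le_power[of m 2] by simp
    then show "\<forall>m\<in>{..N} - {..n}. of_nat ((2 * m) choose (m + k)) * m_odd m n = 0"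
      by (auto simp: m_odd_eq_0)
  qed (use n in auto)
  finally show "fps_nth (macmahon_sum N (int k)) n = fps_nth (macmahon_sum_inf k) n"
    by (simp add: macmahon_sum_inf_def)
qed

text \<open>The triple product coefficient with denominators cleared. Index N + k keeps both lower
  indices, N and N + 2k, natural.\<close>

lemma macmahon_sum_mult_poch:
  "(odd_poch (N + k))\<^sup>2 * macmahon_sum (N + k) (int k) * (even_poch N * even_poch (N + 2 * k)) =
     fps_X ^ (k\<^sup>2) * even_poch (2 * (N + k))"
proof -
  have inv: "inv_even_poch (int M) * even_poch M = 1" for M
    using inverse_mult_eq_1[of "even_poch M"] by (simp add: inv_even_poch_def even_poch_nth_0)
  have "int (N + k) - int k = int N" "int (N + k) + int k = int (N + 2 * k)" "nat ((int k)\<^sup>2) = k\<^sup>2"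
    by (simp_all add: nat_power_eq)
  then have "(odd_poch (N + k))\<^sup>2 * macmahon_sum (N + k) (int k) *
      (even_poch N * even_poch (N + 2 * k)) =
    fps_X ^ (k\<^sup>2) * even_poch (2 * (N + k)) * (inv_even_poch (int N) * even_poch N) *
      (inv_even_poch (int (N + 2 * k)) * even_poch (N + 2 * k))"
    unfolding macmahon_sum_eq_triple_coeff triple_coeff_def by (simp only: mult_ac)
  then show ?thesis
    by (simp only: inv mult_1_right)
qed

text \<open>As N tends to infinity, all three \<open>even_poch\<close> factors tend to (q^2;q^2),
  and one copy cancels from both sides.\<close>

lemma macmahon_sum_inf_mult_qpoch:
  "macmahon_sum_inf k * (qpoch_inf (fps_X ^ 2) (fps_X ^ 2) * (qpoch_inf fps_X (fps_X ^ 2))\<^sup>2) =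
     fps_X ^ (k\<^sup>2)"
proof -
  let ?a = "qpoch_inf (fps_X ^ 2) (fps_X ^ 2)" and ?b = "qpoch_inf fps_X (fps_X ^ 2)"
  have "(\<lambda>N. fps_X ^ (k\<^sup>2) * even_poch (2 * (N + k))) \<longlonglongrightarrow>
      (?b\<^sup>2 * macmahon_sum_inf k) * (?a * ?a)"
    unfolding macmahon_sum_mult_poch[symmetric] power2_eq_square[of "odd_poch _"] power2_eq_square[of ?b]
    by (intro tendsto_mult_fps even_poch_LIMSEQ LIMSEQ_ignore_initial_segment
          odd_poch_LIMSEQ macmahon_sum_LIMSEQ)
  moreover have "(\<lambda>N. fps_X ^ (k\<^sup>2) * even_poch (2 * (N + k))) \<longlonglongrightarrow> fps_X ^ (k\<^sup>2) * ?a"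
    using LIMSEQ_subseq_LIMSEQ[OF even_poch_LIMSEQ, of "\<lambda>N. 2 * (N + k)"]
    by (intro tendsto_mult_fps tendsto_const) (simp add: strict_mono_def comp_def)
  ultimately have "(?b\<^sup>2 * macmahon_sum_inf k) * (?a * ?a) = fps_X ^ (k\<^sup>2) * ?a"
    by (rule LIMSEQ_unique)
  then have "(macmahon_sum_inf k * (?a * ?b\<^sup>2)) * ?a = fps_X ^ (k\<^sup>2) * ?a"
    by (simp only: mult_ac)
  moreover have "?a \<noteq> 0"
    using fps_nth_0_qpoch_inf[of "fps_X ^ 2" "fps_X ^ 2"] by auto
  ultimately show ?thesis
    by (simp only: mult_cancel_right) simp
qed

lemma overpartition_number_eq_macmahon_sum_inf:
  "of_nat (overpartition_number n) = fps_nth (macmahon_sum_inf k) (n + k\<^sup>2)"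
proof -
  let ?P = "Abs_fps (\<lambda>n. of_nat (overpartition_number n)) :: rat fps"
  let ?D = "qpoch_inf (fps_X ^ 2) (fps_X ^ 2) * (qpoch_inf fps_X (fps_X ^ 2))\<^sup>2"
  have "macmahon_sum_inf k = macmahon_sum_inf k * (?P * ?D)"
    by (simp only: overpartition_fps mult_1_right)
  also have "\<dots> = (macmahon_sum_inf k * ?D) * ?P"
    by (simp only: mult_ac)
  also have "\<dots> = fps_X ^ (k\<^sup>2) * ?P"
    by (simp only: macmahon_sum_inf_mult_qpoch)
  finally show ?thesis
    by (simp add: fps_X_power_mult_nth)
qed

text \<open>Only k <= m <= j + k survives: below, the binomial is 0; above, the hypothesis gives n +
  k^2 < (j + k + 1)^2 <= m^2.\<close>

lemma overpartition_number_eq_macmahon_sum: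
  assumes n: "n < (j + 1) * (j + 2 * k + 1)"
  shows "of_nat (overpartition_number n) =
    (\<Sum>m=0..j. of_nat ((2 * m + 2 * k) choose (m + 2 * k)) * m_odd (m + k) (n + k\<^sup>2))"
proof -
  define f where "f m = of_nat ((2 * m) choose (m + k)) * m_odd m (n + k\<^sup>2)" for m
  have large: "f m = 0" if "j + k < m" for m
  proof -
    have "n + k\<^sup>2 < (j + 1 + k)\<^sup>2"
      using n by (simp add: power2_eq_square algebra_simps)
    also have "\<dots> \<le> m\<^sup>2"
      using that by (intro power_mono) auto
    finally show ?thesis
      by (simp add: f_def m_odd_eq_0)
  qed
  have out: "f m = 0" if "n + k\<^sup>2 < m" for m
    using that self_le_power[of m 2] by (simp add: f_def m_odd_eq_0)
  have small: "f m = 0" if "m < k" for m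
    using that by (simp add: f_def binomial_eq_0)
  have "of_nat (overpartition_number n) = sum f {..n + k\<^sup>2}"
    by (simp add: overpartition_number_eq_macmahon_sum_inf[of n k] macmahon_sum_inf_def f_def)
  \<comment> \<open>The range is enlarged first, because n + k^2 may be smaller than j + k.\<close>
  also have "\<dots> = sum f {..n + k\<^sup>2 + j + k}"
    using out by (intro sum.mono_neutral_left) auto
  also have "\<dots> = sum f {0 + k..j + k}"
    using small large by (intro sum.mono_neutral_right) (auto simp: not_le)
  also have "\<dots> = (\<Sum>m=0..j. f (m + k))"
    by (rule sum.shift_bounds_cl_nat_ivl)
  also have "\<dots> = (\<Sum>m=0..j. of_nat ((2 * m + 2 * k) choose (m + 2 * k)) * m_odd (m + k) (n + k\<^sup>2))"
  proof -
    have "2 * (m + k) = 2 * m + 2 * k" "m + k + k = m + 2 * k" for m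
      by simp_all
    then show ?thesis
      by (simp only: f_def)
  qed
  finally show ?thesis .
qed

section \<open>Passage to formal Laurent series\<close>

lemma fls_X_powi_times_nth: "fls_nth (fls_X powi i * f) n = fls_nth (f :: 'a :: field fls) (n - i)"
proof (cases "i \<ge> 0")
  case True
  then show ?thesis
    by (simp add: power_int_def fls_X_power_times_conv_shift)
next
  case False
  then show ?thesis
    by (simp add: power_int_def fls_inverse_X fls_X_inv_power_times_conv_shift)
qed

lemma fls_sum_nth: "fls_nth (sum f A) n = (\<Sum>x\<in>A. fls_nth (f x :: 'a :: comm_ring_1 fls) n)"
  by (induction A rule: infinite_finite_induct) auto

theorem corollary1p4:
  fixes k j :: nat
  shows "(\<exists>R \<in> q_bigo ((j + 1) * (j + 2 * k + 1)).
      fps_to_fls (1 / (qpoch_inf (fps_X ^ 2) (fps_X ^ 2) * (qpoch_inf fps_X (fps_X ^ 2)) ^ 2))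
        = fls_X powi (- (int k ^ 2))
            * (\<Sum>m=0..j. of_nat ((2 * m + 2 * k) choose (m + 2 * k))
                 * fps_to_fls (macmahon_C (m + k)))
          + R) \<and>
    (\<forall>n < (j + 1) * (j + 2 * k + 1).
      of_nat (overpartition_number n)
        = (\<Sum>m=0..j. of_nat ((2 * m + 2 * k) choose (m + 2 * k)) * m_odd (m + k) (n + k ^ 2)))"
proof -
  let ?D = "qpoch_inf (fps_X ^ 2) (fps_X ^ 2) * (qpoch_inf fps_X (fps_X ^ 2)) ^ 2"
  define L where "L = fps_to_fls (1 / ?D)"
  define S where "S = fls_X powi (- (int k ^ 2)) * (\<Sum>m=0..j. of_nat ((2 * m + 2 * k) choose (m + 2 * k))
                 * fps_to_fls (macmahon_C (m + k)))"
  have "inverse ?D = Abs_fps (\<lambda>n. of_nat (overpartition_number n))"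
    by (rule fps_inverse_unique) (simp only: overpartition_fps mult.commute[of ?D])
  moreover have "fps_nth ?D 0 = 1"
    by (simp add: fps_nth_0_qpoch_inf power2_eq_square)
  ultimately have P: "1 / ?D = Abs_fps (\<lambda>n. of_nat (overpartition_number n))"
    by (simp add: fps_divide_unit)
  have S_nth: "fls_nth S i = (\<Sum>m=0..j. of_nat ((2 * m + 2 * k) choose (m + 2 * k)) *
      (if i + int k ^ 2 < 0 then 0 else m_odd (m + k) (nat (i + int k ^ 2))))" for i
    unfolding S_def fls_X_powi_times_nth fls_sum_nth m_odd_def by simp
  have "fls_nth (L - S) i = 0" if i: "i < int ((j + 1) * (j + 2 * k + 1))" for i
  proof (cases "i < 0")
    case True
    \<comment> \<open>The factor q^(-k^2) creates no negative exponents, since C_(m+k) starts no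
      earlier than q^((m+k)^2).\<close>
    have "m_odd (m + k) (nat (i + int k ^ 2)) = 0" if "\<not> i + int k ^ 2 < 0" for m
    proof (rule m_odd_eq_0)
      have "int (nat (i + int k ^ 2)) < int (k\<^sup>2)"
        using True that by simp
      then have "nat (i + int k ^ 2) < k\<^sup>2"
        by (simp only: of_nat_less_iff)
      also have "\<dots> \<le> (m + k)\<^sup>2"
        by (intro power_mono) auto
      finally show "nat (i + int k ^ 2) < (m + k)\<^sup>2" .
    qed
    then have "fls_nth S i = 0"
      unfolding S_nth by (intro sum.neutral) auto
    moreover have "fls_nth L i = 0"
      using True by (simp add: L_def)
    ultimately show ?thesis
      by simp
  next
    case False
    define n where "n = nat i"
    have i_eq: "i = int n"
      using False by (simp add: n_def)
    with i have n: "n < (j + 1) * (j + 2 * k + 1)"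
      by (simp only: of_nat_less_iff)
    have "nat (i + int k ^ 2) = n + k\<^sup>2" "\<not> i + int k ^ 2 < 0"
      unfolding i_eq by (simp_all add: nat_add_distrib nat_power_eq not_less)
    then have "fls_nth S i = (\<Sum>m=0..j. of_nat ((2 * m + 2 * k) choose (m + 2 * k)) * m_odd (m + k) (n + k\<^sup>2))"
      unfolding S_nth using i_eq by simp
    moreover have "fls_nth L i = of_nat (overpartition_number n)"
      unfolding L_def P by (simp add: i_eq)
    ultimately show ?thesis
      using overpartition_number_eq_macmahon_sum[OF n] by simp
  qed
  then have "L - S \<in> q_bigo ((j + 1) * (j + 2 * k + 1))"
    by (auto simp: q_bigo_def)
  \<comment> \<open>The witness for the remainder is the difference of the two sides.\<close>
  moreover have "L = S + (L - S)"
    by simp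
  ultimately show ?thesis
    unfolding L_def S_def using overpartition_number_eq_macmahon_sum by blast
qed

end
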